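(* Let $A$ be an Albert algebra over a field $k$, let $A_0\subset A$ be the subspace of elements of trace zero, and let $\phi\in Aut(A)$. Then there exists a nonzero element $x_0\in A_0$ such that $\phi(x_0)=x_0$.
   Context: Let $J(M_3(F),1)=M_3(F)\oplus M_3(F)\oplus M_3(F)$ for a field $F$, with identity $1=(1,0,0)$, norm (cubic form) $N(x,y,z)=\det x+\det y+\det z-\mathrm{tr}(xyz)$, adjoint $(x_0,x_1,x_2)^{\#}=(x_0^{\#}-x_1x_2,\ x_2^{\#}-x_0x_1,\ x_1^{\#}-x_2x_0)$ (where $y^{\#}$ is the classical adjugate of a $3\times3$ matrix) and trace bilinear form $T(x,y)=\mathrm{tr}(x_0y_0)+\mathrm{tr}(x_1y_2)+\mathrm{tr}(x_2y_1)$. An Albert algebra over $k$ is a 27-dimensional $k$-space $A$ with $1\in A$, a cubic form $N$, a quadratic map $\#$ and a symmetric bilinear form $T$ that becomes isomorphic (by a linear bijection preserving $1,N,\#,T$) to $J(M_3(F),1)$ over some field extension $F/k$. (In characteristic $\neq 2$ this is the same as a form of the split 27-dimensional exceptional simple Jordan algebra.) The trace is the linear form $T(x)=T(x,1)$, and $A_0=\{x\in A: T(x)=0\}$. $Aut(A)$ is the group of $k$-linear bijections of $A$ preserving $1,N,\#,T$. *)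

theory Defs
  imports
    "HOL-Analysis.Determinants"
    "HOL-Analysis.Product_Vector"
    "HOL-Library.Numeral_Type"
    "HOL-Computational_Algebra.Polynomial"
begin

section \<open>Quadratic maps and cubic forms on vector spaces over arbitrary fields\<close>

definition bilinear_map ::
  "('k::field \<Rightarrow> 'a::ab_group_add \<Rightarrow> 'a) \<Rightarrow> ('k \<Rightarrow> 'b::ab_group_add \<Rightarrow> 'b) \<Rightarrow> ('a \<Rightarrow> 'a \<Rightarrow> 'b) \<Rightarrow> bool"
  where "bilinear_map s t b \<longleftrightarrow>
    (\<forall>x. Vector_Spaces.linear s t (\<lambda>y. b x y)) \<and> (\<forall>y. Vector_Spaces.linear s t (\<lambda>x. b x y))"

definition quadratic_map ::
  "('k::field \<Rightarrow> 'a::ab_group_add \<Rightarrow> 'a) \<Rightarrow> ('k \<Rightarrow> 'b::ab_group_add \<Rightarrow> 'b) \<Rightarrow> ('a \<Rightarrow> 'b) \<Rightarrow> bool"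
  where "quadratic_map s t q \<longleftrightarrow>
    (\<forall>c x. q (s c x) = t (c^2) (q x)) \<and> bilinear_map s t (\<lambda>x y. q (x + y) - q x - q y)"

text \<open>
  A cubic form is a homogeneous polynomial of degree 3, and over a field with two elements it is
  not determined by its values (\<open>X\<^sup>2Y + XY\<^sup>2\<close> vanishes everywhere on the plane).  As in the theory of
  cubic norm structures over arbitrary rings, it is therefore encoded as a pair of functions: its
  values \<open>N\<close> and its first polarization \<open>D\<close>, where \<open>D x y\<close> is the coefficient of \<open>t\<close> in
  \<open>N (x + t y)\<close>.  On a finite-dimensional space such pairs correspond bijectively to homogeneous
  polynomials of degree 3: in coordinates with respect to a basis \<open>e\<close>, the coefficient of
  \<open>X\<^sub>i\<^sup>3\<close> is \<open>N e\<^sub>i\<close>, that of \<open>X\<^sub>i\<^sup>2X\<^sub>j\<close> is \<open>D e\<^sub>i e\<^sub>j\<close>, and that of \<open>X\<^sub>iX\<^sub>jX\<^sub>l\<close> is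
  \<open>D (e\<^sub>i + e\<^sub>j) e\<^sub>l - D e\<^sub>i e\<^sub>l - D e\<^sub>j e\<^sub>l\<close>.
\<close>

definition cubic_form ::
  "('k::field \<Rightarrow> 'a::ab_group_add \<Rightarrow> 'a) \<Rightarrow> ('a \<Rightarrow> 'k) \<Rightarrow> ('a \<Rightarrow> 'a \<Rightarrow> 'k) \<Rightarrow> bool"
  where "cubic_form s N D \<longleftrightarrow>
    (\<forall>c x. N (s c x) = c^3 * N x) \<and>
    (\<forall>x. Vector_Spaces.linear s (*) (\<lambda>y. D x y)) \<and>
    (\<forall>y. quadratic_map s (*) (\<lambda>x. D x y)) \<and>
    (\<forall>x y. N (x + y) = N x + D x y + D y x + N y) \<and>
    (\<forall>x. D x x = 3 * N x)"

section \<open>Spaces with a unit, cubic form, adjoint and trace form\<close>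

record ('k, 'a) cubic_space =
  smult :: "'k \<Rightarrow> 'a \<Rightarrow> 'a"
  unit :: "'a"
  norm_form :: "'a \<Rightarrow> 'k"
  norm_polar :: "'a \<Rightarrow> 'a \<Rightarrow> 'k"
  adj :: "'a \<Rightarrow> 'a"
  trace_form :: "'a \<Rightarrow> 'a \<Rightarrow> 'k"

definition cubic_space :: "('k::field, 'a::ab_group_add) cubic_space \<Rightarrow> bool"
  where "cubic_space A \<longleftrightarrow>
    vector_space (smult A) \<and>
    cubic_form (smult A) (norm_form A) (norm_polar A) \<and>
    quadratic_map (smult A) (smult A) (adj A) \<and>
    bilinear_map (smult A) (*) (trace_form A) \<and>
    (\<forall>x y. trace_form A x y = trace_form A y x)"

definition cubic_space_iso ::
  "('k::field, 'a::ab_group_add) cubic_space \<Rightarrow> ('k, 'b::ab_group_add) cubic_space \<Rightarrow> ('a \<Rightarrow> 'b) \<Rightarrow> bool"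
  where "cubic_space_iso A B f \<longleftrightarrow>
    Vector_Spaces.linear (smult A) (smult B) f \<and> bij f \<and>
    f (unit A) = unit B \<and>
    (\<forall>x. norm_form B (f x) = norm_form A x) \<and>
    (\<forall>x y. norm_polar B (f x) (f y) = norm_polar A x y) \<and>
    (\<forall>x. adj B (f x) = f (adj A x)) \<and>
    (\<forall>x y. trace_form B (f x) (f y) = trace_form A x y)"

definition Aut :: "('k::field, 'a::ab_group_add) cubic_space \<Rightarrow> ('a \<Rightarrow> 'a) set"
  where "Aut A = {f. cubic_space_iso A A f}"

definition trace_zero :: "('k::field, 'a::ab_group_add) cubic_space \<Rightarrow> 'a set"
  where "trace_zero A = {x. trace_form A x (unit A) = 0}"

section \<open>Scalar extension\<close>

definition field_extension :: "('k::field \<Rightarrow> 'f::field) \<Rightarrow> bool"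
  where "field_extension \<iota> \<longleftrightarrow>
    \<iota> 1 = 1 \<and> (\<forall>a b. \<iota> (a + b) = \<iota> a + \<iota> b) \<and> (\<forall>a b. \<iota> (a * b) = \<iota> a * \<iota> b)"

text \<open>
  \<open>E\<close>, together with the canonical map \<open>j\<close> playing the role of \<open>x \<mapsto> x \<otimes> 1\<close>, is the scalar extension
  of \<open>A\<close> along \<open>\<iota>\<close>: the \<open>\<iota>\<close>-semilinear map \<open>j\<close> sends a basis of \<open>A\<close> to a basis of \<open>E\<close> (which
  identifies the vector space of \<open>E\<close> with \<open>A \<otimes> F\<close>), and the unit, cubic form, quadratic map and
  bilinear form of \<open>E\<close> extend those of \<open>A\<close>, which determines them uniquely.
\<close>

definition scalar_extension ::
  "('k::field \<Rightarrow> 'f::field) \<Rightarrow> ('k, 'a::ab_group_add) cubic_space \<Rightarrow>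
   ('f, 'b::ab_group_add) cubic_space \<Rightarrow> ('a \<Rightarrow> 'b) \<Rightarrow> bool"
  where "scalar_extension \<iota> A E j \<longleftrightarrow>
    cubic_space E \<and>
    (\<forall>x y. j (x + y) = j x + j y) \<and>
    (\<forall>c x. j (smult A c x) = smult E (\<iota> c) (j x)) \<and>
    (\<exists>B. \<not> module.dependent (smult A) B \<and> module.span (smult A) B = UNIV \<and> inj_on j B \<and>
         \<not> module.dependent (smult E) (j ` B) \<and> module.span (smult E) (j ` B) = UNIV) \<and>
    j (unit A) = unit E \<and>
    (\<forall>x. norm_form E (j x) = \<iota> (norm_form A x)) \<and>
    (\<forall>x y. norm_polar E (j x) (j y) = \<iota> (norm_polar A x y)) \<and>
    (\<forall>x. adj E (j x) = j (adj A x)) \<and>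
    (\<forall>x y. trace_form E (j x) (j y) = \<iota> (trace_form A x y))"

section \<open>The split structure on three copies of the 3 by 3 matrices\<close>

type_synonym 'r mat3_triple = "('r^3^3) \<times> ('r^3^3) \<times> ('r^3^3)"

text \<open>Indices of type \<open>3\<close> are added modulo 3, which absorbs the signs of the cofactors.\<close>

definition adjugate3 :: "'r::comm_ring_1^3^3 \<Rightarrow> 'r^3^3"
  where "adjugate3 x = (\<chi> i j.
    x $ (j + 1) $ (i + 1) * x $ (j + 2) $ (i + 2) - x $ (j + 1) $ (i + 2) * x $ (j + 2) $ (i + 1))"

lemma adjugate3_mult:
  fixes x :: "'r::comm_ring_1^3^3"
  shows "x ** adjugate3 x = mat (det x)" "adjugate3 x ** x = mat (det x)"
proof -
  have n: "(4::3) = 1" "(5::3) = 2" by simp_all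
  show "x ** adjugate3 x = mat (det x)" "adjugate3 x ** x = mat (det x)"
    by (simp_all add: adjugate3_def matrix_matrix_mult_def mat_def det_3 vec_eq_iff forall_3 sum_3
        n algebra_simps)
qed

fun J_norm :: "'r::comm_ring_1 mat3_triple \<Rightarrow> 'r"
  where "J_norm (x, y, z) = det x + det y + det z - trace (x ** y ** z)"

fun J_adj :: "'r::comm_ring_1 mat3_triple \<Rightarrow> 'r mat3_triple"
  where "J_adj (x\<^sub>0, x\<^sub>1, x\<^sub>2) =
    (adjugate3 x\<^sub>0 - x\<^sub>1 ** x\<^sub>2, adjugate3 x\<^sub>2 - x\<^sub>0 ** x\<^sub>1, adjugate3 x\<^sub>1 - x\<^sub>2 ** x\<^sub>0)"

fun J_trace_form :: "'r::comm_ring_1 mat3_triple \<Rightarrow> 'r mat3_triple \<Rightarrow> 'r"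
  where "J_trace_form (x\<^sub>0, x\<^sub>1, x\<^sub>2) (y\<^sub>0, y\<^sub>1, y\<^sub>2) =
    trace (x\<^sub>0 ** y\<^sub>0) + trace (x\<^sub>1 ** y\<^sub>2) + trace (x\<^sub>2 ** y\<^sub>1)"

fun J_smult :: "'r::comm_ring_1 \<Rightarrow> 'r mat3_triple \<Rightarrow> 'r mat3_triple"
  where "J_smult c (x, y, z) = (map_matrix ((*) c) x, map_matrix ((*) c) y, map_matrix ((*) c) z)"

text \<open>\<open>J_line x y\<close> is \<open>x + t y\<close>, a triple of matrices over the polynomials in \<open>t\<close>.\<close>

fun J_line :: "'r::comm_ring_1 mat3_triple \<Rightarrow> 'r mat3_triple \<Rightarrow> 'r poly mat3_triple"
  where "J_line (x\<^sub>0, x\<^sub>1, x\<^sub>2) (y\<^sub>0, y\<^sub>1, y\<^sub>2) =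
    ((\<chi> i j. [:x\<^sub>0 $ i $ j, y\<^sub>0 $ i $ j:]), (\<chi> i j. [:x\<^sub>1 $ i $ j, y\<^sub>1 $ i $ j:]),
     (\<chi> i j. [:x\<^sub>2 $ i $ j, y\<^sub>2 $ i $ j:]))"

definition J_norm_polar :: "'r::comm_ring_1 mat3_triple \<Rightarrow> 'r mat3_triple \<Rightarrow> 'r"
  where "J_norm_polar x y = coeff (J_norm (J_line x y)) 1"

definition J_split :: "('f::field, 'f mat3_triple) cubic_space"
  where "J_split = \<lparr>smult = J_smult, unit = (mat 1, 0, 0), norm_form = J_norm,
    norm_polar = J_norm_polar, adj = J_adj, trace_form = J_trace_form\<rparr>"

section \<open>Albert algebras\<close>

text \<open>
  HOL cannot quantify existentially over the type of the extension field inside a definition, so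
  the splitting extension \<open>\<iota>\<close> is a parameter: \<open>A\<close> is an Albert algebra iff
  \<open>albert_algebra_split_by \<iota> A\<close> holds for some field extension \<open>\<iota>\<close>.  The underlying vector space of
  the 27-dimensional scalar extension is taken to be \<open>F\<^sup>2\<^sup>7\<close> without loss of generality.
\<close>

definition albert_algebra_split_by ::
  "('k::field \<Rightarrow> 'f::field) \<Rightarrow> ('k, 'a::ab_group_add) cubic_space \<Rightarrow> bool"
  where "albert_algebra_split_by \<iota> A \<longleftrightarrow>
    cubic_space A \<and> vector_space.dim (smult A) UNIV = 27 \<and> field_extension \<iota> \<and>
    (\<exists>(E :: ('f, 'f^27) cubic_space) j f.
       smult E = (*s) \<and> scalar_extension \<iota> A E j \<and> cubic_space_iso E J_split f)"

end

theory Submission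
  imports "HOL-Algebra.Algebraic_Closure_Type" Defs
begin

text \<open>
  Fixed vectors of trace zero are the solutions of linear equations over \<open>k\<close>, so it suffices to find
  one after extension of scalars to an algebraically closed field, where the algebra is split: the
  automorphism extends (\<open>linear_extension\<close>, \<open>extension_preserves\<close>), and if it fixes no nonzero trace-zero
  element over \<open>k\<close>, then the extended automorphism does not either (\<open>no_fixed_point_extends\<close>).  In
  characteristic 3 the unit has trace \<open>3 = 0\<close> and is a solution.  From now on let 3 be invertible.

  Let \<open>g\<close> be an automorphism over an algebraically closed field, \<open>V\<close> the split algebra and
  \<open>V\<^sub>0\<close> its subspace of trace zero, and suppose that \<open>g\<close> fixes no nonzero element of \<open>V\<^sub>0\<close>.  As \<open>V\<close> is
  the direct sum of the scalars and \<open>V\<^sub>0\<close>, the generalized eigenspace of \<open>g\<close> for the eigenvalue 1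
  consists of the scalars.  This smallness is contradicted as follows.

  The products \<open>x \<mapsto> x\<^sup>#\<close> and \<open>(x, y) \<mapsto> x \<times> y\<close>, the polarization of \<open>#\<close>, multiply eigenvalues.  Let
  \<open>x \<in> V\<^sub>0\<close> be an eigenvector for \<open>c\<close>.  Some \<open>y\<close> in the generalized eigenspace for \<open>1/c\<close> pairs
  nontrivially with \<open>x\<close>, and \<open>x \<times> y\<close> is a scalar.  The identity \<open>(x \<times> y)\<^sup># = T(x, y\<^sup>#) x\<close>, valid
  when \<open>x\<^sup># = 0\<close>, makes this scalar zero, whereas its trace is \<open>- T(x, y)\<close>; so \<open>x\<^sup># \<noteq> 0\<close>
  (\<open>eigenvector_sharp_nonzero\<close>).  By the adjoint identity \<open>x\<^sup>#\<^sup># = N(x) x\<close> also \<open>N(x) \<noteq> 0\<close>, and then \<open>c\<close>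
  is a primitive cube root of unity.  Invariance of \<open>T(x\<^sup>#, \<cdot>)\<close> excludes Jordan blocks, because
  \<open>T(x\<^sup>#, x) = 3 N(x)\<close>.  Hence \<open>g\<^sup>2 + g + 1 = 0\<close> on \<open>V\<^sub>0\<close> (\<open>cubic_relation_on_trace_zero\<close>).

  Finally \<open>V\<^sub>0\<close> contains an element \<open>e \<noteq> 0\<close> with \<open>e\<^sup># = 0\<close>, a matrix unit.  It is the sum of its components
  \<open>a\<close> and \<open>b\<close> in the two eigenspaces, and \<open>a\<^sup>#\<close>, \<open>b\<^sup>#\<close> and \<open>a \<times> b\<close> have distinct eigenvalues, so
  \<open>e\<^sup># = 0\<close> forces \<open>a\<^sup># = b\<^sup># = 0\<close> and thus \<open>a = b = 0\<close> (\<open>trace_zero_sharp_zero_imp_zero\<close>).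
\<close>

(* In what follows $ is indexing of vectors and matrices. *)
no_notation fps_nth (infixl \<open>$\<close> 75)

section \<open>Polynomials in a linear operator\<close>

locale linear_operator = vector_space scale
  for scale :: "'k::field \<Rightarrow> 'v::ab_group_add \<Rightarrow> 'v" +
  fixes g :: "'v \<Rightarrow> 'v"
  assumes linear_g: "Vector_Spaces.linear scale scale g"
begin

sublocale g: Vector_Spaces.linear scale scale g
  by (rule linear_g)

definition poly_act :: "'k poly \<Rightarrow> 'v \<Rightarrow> 'v"
  where "poly_act p v = fold_coeffs (\<lambda>a w. scale a v + g w) p 0"

lemma poly_act_0: "poly_act 0 v = 0"
  by (simp add: poly_act_def)

lemma poly_act_pCons: "poly_act (pCons a p) v = scale a v + g (poly_act p v)"
  by (cases "p = 0 \<and> a = 0") (auto simp: poly_act_def g.zero)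

lemma poly_act_add: "poly_act (p + q) v = poly_act p v + poly_act q v"
  by (induction p q rule: poly_induct2)
    (simp_all add: poly_act_0 poly_act_pCons g.add scale_left_distrib)

lemma poly_act_smult: "poly_act (Polynomial.smult c p) v = scale c (poly_act p v)"
  by (induction p) (simp_all add: poly_act_0 poly_act_pCons g.scale scale_right_distrib)

lemma poly_act_mult: "poly_act (p * q) v = poly_act p (poly_act q v)"
  by (induction p)
    (simp_all add: poly_act_0 poly_act_pCons poly_act_add poly_act_smult)

lemma poly_act_monom: "poly_act (monom c n) v = scale c ((g ^^ n) v)"
  by (induction n) (simp_all add: poly_act_0 poly_act_pCons monom_0 monom_Suc g.zero g.scale)

lemma poly_act_in_subspace:
  assumes "subspace W" "g ` W \<subseteq> W" "v \<in> W"
  shows "poly_act p v \<in> W"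
  using assms by (induction p) (auto simp: poly_act_0 poly_act_pCons subspace_0 subspace_add subspace_scale)

text \<open>
  The iterates \<open>v, g v, g\<^sup>2 v, \<dots>\<close> cannot all be independent.  The first one that depends on its
  predecessors yields a monic annihilating polynomial.
\<close>

lemma annihilating_poly_exists:
  assumes fin: "finite B" "span B = UNIV"
  obtains p where "p \<noteq> 0" "poly_act p v = 0"
proof -
  let ?S = "\<lambda>n. (\<lambda>i. (g ^^ i) v) ` {..<n}"
  have "\<exists>n. (g ^^ n) v \<in> span (?S n)"
  proof (rule ccontr, unfold not_ex)
    assume "\<forall>n. (g ^^ n) v \<notin> span (?S n)"
    note out = this[rule_format]
    have ind: "independent (?S n) \<and> card (?S n) = n" for n
    proof (induction n)
      case (Suc n)
      have nin: "(g ^^ n) v \<notin> ?S n" by (rule contra_subsetD[OF span_superset out])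
      have S: "?S (Suc n) = insert ((g ^^ n) v) (?S n)" by (simp only: lessThan_Suc image_insert)
      have "independent (?S (Suc n))"
        unfolding S by (rule independent_insertI[OF out]) (use Suc in blast)
      moreover have "card (?S (Suc n)) = Suc n"
        unfolding S using card_insert_disjoint[OF _ nin] Suc by simp
      ultimately show ?case by blast
    qed (simp add: independent_empty)
    then have "card (?S (Suc (card B))) \<le> card B"
      using independent_span_bound[OF fin(1)] fin(2) by blast
    then show False using ind[of "Suc (card B)"] by simp
  qed
  then obtain n where "(g ^^ n) v \<in> span (?S n)" by blast
  also have "span (?S n) \<subseteq> {poly_act p v |p. \<forall>i\<ge>n. coeff p i = 0}" (is "_ \<subseteq> ?W")
  proof (rule span_minimal)
    show "?S n \<subseteq> ?W"
    proof clarify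
      fix i assume "i < n"
      then show "\<exists>p. (g ^^ i) v = poly_act p v \<and> (\<forall>i\<ge>n. coeff p i = 0)"
        by (intro exI[of _ "monom 1 i"]) (simp add: poly_act_monom)
    qed
    show "subspace ?W"
    proof (rule subspaceI)
      show "0 \<in> ?W" using poly_act_0[of v] by force
      show "x + y \<in> ?W" if "x \<in> ?W" "y \<in> ?W" for x y
        using that poly_act_add[of _ _ v] by clarsimp (metis coeff_add add_0)
      show "scale c x \<in> ?W" if "x \<in> ?W" for c x
        using that poly_act_smult[of c _ v] by clarsimp (metis coeff_smult mult_zero_right)
    qed
  qed
  finally obtain q where q: "(g ^^ n) v = poly_act q v" "coeff q n = 0" by blast
  let ?p = "monom 1 n - q"
  have "coeff ?p n = 1" using q by simp
  then have "?p \<noteq> 0" by auto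
  moreover have "poly_act ?p v = 0"
    using q poly_act_add[of ?p q v] by (simp add: poly_act_monom)
  ultimately show thesis by (rule that)
qed

text \<open>
  If \<open>p\<close> is an annihilating polynomial of \<open>v\<close> of least degree and \<open>p = (X - c) q\<close>, then \<open>q(g) v\<close> is an
  eigenvector: it does not vanish because \<open>q\<close> has smaller degree.
\<close>

lemma eigenvector_exists:
  assumes alg_closed: "\<forall>p :: 'k poly. degree p > 0 \<longrightarrow> (\<exists>x. poly p x = 0)"
    and fin: "finite B" "span B = UNIV"
    and W: "subspace W" "g ` W \<subseteq> W"
    and v: "v \<in> W" "v \<noteq> 0"
  obtains w c where "w \<in> W" "w \<noteq> 0" "g w = scale c w"
proof -
  let ?P = "\<lambda>p. p \<noteq> 0 \<and> poly_act p v = 0"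
  obtain p0 where "?P p0" using annihilating_poly_exists[OF fin] by blast
  then obtain p where p: "?P p" and min: "\<And>q. ?P q \<Longrightarrow> degree p \<le> degree q"
    using ex_has_least_nat[of ?P p0 degree] by blast
  have "degree p > 0"
  proof (rule ccontr)
    assume "\<not> degree p > 0"
    then obtain a where "p = [:a:]" using degree_eq_zeroE by blast
    then show False using p v by (simp add: poly_act_pCons poly_act_0 g.zero)
  qed
  then obtain c where "poly p c = 0" using alg_closed by blast
  then obtain q where pq: "p = [:- c, 1:] * q" by (auto simp: poly_eq_0_iff_dvd elim: dvdE)
  let ?w = "poly_act q v"
  have "q \<noteq> 0" using p pq by auto
  then have "degree p = Suc (degree q)" using degree_mult_eq[of "[:- c, 1:]" q] pq by simp
  then have w0: "?w \<noteq> 0" using min[of q] \<open>q \<noteq> 0\<close> by auto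
  have "poly_act [:- c, 1:] ?w = 0" using p pq by (simp only: poly_act_mult)
  then have gw: "g ?w = scale c ?w"
    by (simp add: poly_act_pCons poly_act_0 g.zero)
  show thesis by (rule that[OF poly_act_in_subspace[OF W v(1)] w0 gw])
qed

text \<open>
  This is the part of Fitting's decomposition needed below: a functional \<open>l\<close> that kills the image of \<open>g\<close>
  is determined by its values on the vectors on which \<open>g\<close> is nilpotent.  Write an annihilating
  polynomial of \<open>y\<close> as \<open>X\<^sup>n q\<close> with \<open>q(0) \<noteq> 0\<close>; then \<open>g\<^sup>n\<close> kills \<open>q(g) y\<close>, and \<open>l (q(g) y) = q(0) l y\<close>.
\<close>

lemma nilpotent_vector_with_nonzero_value:
  assumes fin: "finite B" "span B = UNIV"
    and l: "Vector_Spaces.linear scale (*) l"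
    and van: "\<And>z. l (g z) = 0" and y: "l y \<noteq> 0"
  obtains z n where "(g ^^ n) z = 0" "l z \<noteq> 0"
proof -
  interpret l: Vector_Spaces.linear scale "(*)" l by (rule l)
  obtain p where p: "p \<noteq> 0" "poly_act p y = 0" using annihilating_poly_exists[OF fin] .
  obtain n q where q: "p = [:- 0, 1:] ^ n * q" "\<not> [:- 0, 1:] dvd q"
    using order_decomp[OF p(1), of 0] by blast
  obtain a r where ar: "q = pCons a r" by (cases q)
  have "poly q 0 \<noteq> 0" using q(2) by (simp only: poly_eq_0_iff_dvd not_False_eq_True)
  then have "a \<noteq> 0" using ar by simp
  let ?z = "poly_act q y"
  have "p = monom 1 n * q" using q(1) by (simp add: monom_altdef)
  then have "(g ^^ n) ?z = 0"
    using p(2) poly_act_mult[of "monom 1 n" q y] poly_act_monom[of 1 n ?z] by simp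
  moreover have "l ?z = a * l y"
    unfolding ar poly_act_pCons l.add l.scale van by simp
  then have "l ?z \<noteq> 0" using \<open>a \<noteq> 0\<close> y by simp
  ultimately show thesis by (rule that[of n ?z])
qed

end

section \<open>Fixed vectors of automorphisms of cubic norm structures\<close>

lemma primitive_cube_root_simps:
  fixes c :: "'k::field"
  assumes "c\<^sup>2 + c + 1 = 0"
  shows "c * (- 1 - c) = 1" and "c\<^sup>2 = - 1 - c" and "(- 1 - c)\<^sup>2 = c"
proof -
  have "c * (- 1 - c) = 1 - (c\<^sup>2 + c + 1)" "c\<^sup>2 = (c\<^sup>2 + c + 1) + (- 1 - c)"
    "(- 1 - c)\<^sup>2 = (c\<^sup>2 + c + 1) + c"
    by (simp_all add: algebra_simps power2_eq_square)
  then show "c * (- 1 - c) = 1" "c\<^sup>2 = - 1 - c" "(- 1 - c)\<^sup>2 = c"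
    unfolding assms by simp_all
qed

text \<open>
  The map \<open>sharp\<close> is the adjoint \<open>x \<mapsto> x\<^sup>#\<close>.  By \<open>N_add\<close>, the first polarization of the cubic form is
  \<open>(x, y) \<mapsto> T x\<^sup># y\<close>.
\<close>

locale cubic_norm_structure = vector_space scale
  for scale :: "'k::field \<Rightarrow> 'v::ab_group_add \<Rightarrow> 'v" +
  fixes one :: 'v and N :: "'v \<Rightarrow> 'k" and sharp :: "'v \<Rightarrow> 'v" and T :: "'v \<Rightarrow> 'v \<Rightarrow> 'k"
  assumes T_bilinear: "bilinear_map scale (*) T"
    and T_commute: "T x y = T y x"
    and T_nondegenerate: "(\<And>y. T x y = 0) \<Longrightarrow> x = 0"
    and sharp_quadratic: "quadratic_map scale scale sharp"
    and N_scale: "N (scale c x) = c ^ 3 * N x"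
    and N_add: "N (x + y) = N x + T (sharp x) y + T x (sharp y) + N y"
    and T_sharp_self: "T (sharp x) x = 3 * N x"
    and sharp_sharp: "sharp (sharp x) = scale (N x) x"
    and sharp_one: "sharp one = one"
    and T_one_one: "T one one = 3"
    and T_cross_one:
      "T (sharp (x + y) - sharp x - sharp y) one = T x one * T y one - T x y"
begin

definition cross :: "'v \<Rightarrow> 'v \<Rightarrow> 'v"
  where "cross x y = sharp (x + y) - sharp x - sharp y"

lemma linear_T_right: "Vector_Spaces.linear scale (*) (T x)"
  and linear_T_left: "Vector_Spaces.linear scale (*) (\<lambda>x. T x y)"
  using T_bilinear by (simp_all add: bilinear_map_def)

lemma linear_cross_right: "Vector_Spaces.linear scale scale (cross x)"
  and linear_cross_left: "Vector_Spaces.linear scale scale (\<lambda>x. cross x y)"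
  using sharp_quadratic by (simp_all add: quadratic_map_def bilinear_map_def cross_def[abs_def])

lemma T_add: "T (x + y) z = T x z + T y z" "T z (x + y) = T z x + T z y"
  and T_scale: "T (scale c x) z = c * T x z" "T z (scale c x) = c * T z x"
  using linear_T_left linear_T_right by (simp_all add: Vector_Spaces.linear_iff)

lemma T_zero: "T 0 z = 0" "T z 0 = 0"
  using T_scale(1)[of 0 0 z] T_scale(2)[of z 0 0] by simp_all

lemma T_diff: "T (x - y) z = T x z - T y z" "T z (x - y) = T z x - T z y"
  using T_add(1)[of "x - y" y z] T_add(2)[of z "x - y" y] by simp_all

sublocale cross_right: Vector_Spaces.linear scale scale "cross x" for x by (rule linear_cross_right)
sublocale cross_left: Vector_Spaces.linear scale scale "\<lambda>x. cross x y" for y by (rule linear_cross_left)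

lemmas T_simps = T_add T_scale T_diff T_zero
lemmas cross_simps = cross_left.add cross_left.scale cross_left.diff cross_left.neg cross_left.zero
  cross_right.add cross_right.scale cross_right.diff cross_right.neg cross_right.zero

lemma sharp_scale: "sharp (scale c x) = scale (c\<^sup>2) (sharp x)"
  using sharp_quadratic by (simp add: quadratic_map_def)

lemma sharp_zero: "sharp 0 = 0"
  using sharp_scale[of 0 0] by simp

lemma sharp_add: "sharp (x + y) = sharp x + cross x y + sharp y"
  by (simp add: cross_def)

lemma one_nonzero:
  assumes "(3::'k) \<noteq> 0"
  shows "one \<noteq> 0"
  using T_one_one assms T_simps by auto

text \<open>
  If \<open>x\<^sup># = 0\<close>, the adjoint identity \<open>z\<^sup>#\<^sup># = N(z) z\<close> at \<open>z = x + t y\<close> can be divided by \<open>t\<^sup>2\<close>.  The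
  quadratic terms that remain agree by the adjoint identity at \<open>y\<close>, and the claim compares the
  constant terms.  The two values \<open>1\<close> and \<open>u\<close> of \<open>t\<close> suffice to separate them from the linear terms.
\<close>

lemma sharp_cross_of_sharp_zero:
  assumes u: "u \<noteq> 0" "u \<noteq> (1::'k)" and x: "sharp x = 0"
  shows "sharp (cross x y) = scale (T x (sharp y)) x"
proof (cases "x = 0")
  case True
  then show ?thesis by (simp add: cross_simps sharp_zero)
next
  case False
  then have "N x = 0" using sharp_sharp[of x] x by (simp add: sharp_zero)
  let ?b = "cross x y" and ?c = "sharp y" and ?d = "T x (sharp y)"
  have eq: "sharp ?b + scale t (cross ?b ?c) =
      scale ?d x + scale t (scale (N y) x + scale ?d y)" if "t \<noteq> 0" for t
  proof -
    have "sharp (x + scale t y) = scale t (?b + scale t ?c)"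
      by (simp add: sharp_add sharp_scale x cross_simps scale_right_distrib power2_eq_square)
    then have "sharp (sharp (x + scale t y)) =
        scale (t\<^sup>2) (sharp ?b + scale t (cross ?b ?c) + scale (t\<^sup>2) (sharp ?c))"
      by (simp add: sharp_add sharp_scale cross_simps)
    moreover have "N (x + scale t y) = t\<^sup>2 * (?d + t * N y)"
      by (simp add: N_add x \<open>N x = 0\<close> N_scale sharp_scale T_simps algebra_simps power3_eq_cube
          power2_eq_square)
    ultimately have "scale (t\<^sup>2) (sharp ?b + scale t (cross ?b ?c) + scale (t\<^sup>2) (sharp ?c)) =
        scale (t\<^sup>2) (scale (?d + t * N y) (x + scale t y))"
      using sharp_sharp[of "x + scale t y"] by simp
    then have "sharp ?b + scale t (cross ?b ?c) + scale (t\<^sup>2) (sharp ?c) =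
        scale (?d + t * N y) (x + scale t y)"
      by (rule scale_left_imp_eq[rotated]) (use that in simp)
    then show ?thesis
      by (simp add: sharp_sharp scale_left_distrib scale_right_distrib power2_eq_square
          algebra_simps)
  qed
  let ?p = "sharp ?b - scale ?d x"
    and ?q = "scale (N y) x + scale ?d y - cross ?b ?c"
  \<comment> \<open>The left-hand side does not depend on \<open>t\<close>.\<close>
  have p: "?p = scale t ?q" if "t \<noteq> 0" for t
    using eq[OF that] by (simp add: scale_right_diff_distrib algebra_simps)
  have "scale (1 - u) ?q = 0"
    using p[of 1] p[OF u(1)] by (simp add: scale_left_diff_distrib)
  then have "?q = 0" using u(2) by simp
  then have "?p = 0" using p[of 1] by simp
  then show ?thesis by simp
qed

end

text \<open>
  The setting of an argument by contradiction: an automorphism \<open>g\<close> without nonzero fixed vectors of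
  trace zero, over an algebraically closed field of characteristic different from 3.  It is shown
  that then no nonzero element of trace zero has adjoint zero, which is false for the split
  structure.
\<close>

locale fixed_point_free_automorphism = cubic_norm_structure + linear_operator scale g for g +
  assumes g_one: "g one = one"
    and g_sharp: "g (sharp x) = sharp (g x)"
    and g_T: "T (g x) (g y) = T x y"
    and three_nonzero: "(3::'a) \<noteq> 0"
    and no_fixed_trace_zero: "T x one = 0 \<Longrightarrow> g x = x \<Longrightarrow> x = 0"
    and roots: "\<forall>p :: 'a poly. degree p > 0 \<longrightarrow> (\<exists>r. poly p r = 0)"
    and finite_span: "\<exists>B. finite B \<and> span B = UNIV"
begin

lemma g_cross: "g (cross x y) = cross (g x) (g y)"
  by (simp add: cross_def g.diff g.add g_sharp)

lemma g_inj: "g x = 0 \<Longrightarrow> x = 0"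
  using T_nondegenerate g_T T_zero by metis

lemma trace_g: "T (g x) one = T x one"
  using g_T[of x one] by (simp add: g_one)

lemma scale_one_plus_trace_zero:
  obtains c z where "x = scale c one + z" "T z one = 0"
  using that[of "T x one / 3" "x - scale (T x one / 3) one"] three_nonzero
  by (simp add: T_simps T_one_one)

text \<open>
  As \<open>T 1 1 = 3\<close> is invertible, the space is the direct sum of the scalars, which \<open>g - 1\<close> kills,
  and of the elements of trace zero, on which \<open>g - 1\<close> is injective.
\<close>

lemma eventually_fixed_imp_scalar:
  assumes "((\<lambda>x. g x - x) ^^ n) x = 0"
  obtains c where "x = scale c one"
proof -
  have "\<exists>c. x = scale c one" using assms
  proof (induction n arbitrary: x)
    case 0
    then show ?case by (intro exI[of _ 0]) simp
  next
    case (Suc n)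
    obtain c where c: "g x - x = scale c one"
      using Suc by (auto simp: funpow_swap1 simp del: funpow.simps simp: funpow_Suc_right)
    then have "T (g x - x) one = c * 3" by (simp add: T_simps T_one_one)
    then have "c = 0" using trace_g three_nonzero by (simp add: T_simps)
    obtain d z where dz: "x = scale d one + z" "T z one = 0"
      by (rule scale_one_plus_trace_zero)
    have "g z = z" using c \<open>c = 0\<close> dz by (simp add: g.add g.scale g_one)
    then have "z = 0" using no_fixed_trace_zero dz by blast
    then show ?case using dz by auto
  qed
  then show thesis using that by blast
qed

lemma fixed_imp_scalar:
  assumes "g x = x"
  obtains c where "x = scale c one"
  using eventually_fixed_imp_scalar[of 1 x] assms by auto

lemma primitive_cube_root_exists: "\<exists>r::'a. r\<^sup>2 + r + 1 = 0"
  using roots[rule_format, of "[:1, 1, 1:]"] by (auto simp: algebra_simps power2_eq_square)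

lemma exists_scalar_not_0_1: "\<exists>u::'a. u \<noteq> 0 \<and> u \<noteq> 1"
proof -
  obtain r :: 'a where r: "r\<^sup>2 + r + 1 = 0" using primitive_cube_root_exists by blast
  then have "r \<noteq> 0" "r \<noteq> 1" using three_nonzero by auto
  then show ?thesis by blast
qed

text \<open>
  The crucial step.  Since \<open>g\<close> is an isometry, \<open>T x\<close> kills the image of \<open>c g - 1\<close>, so some \<open>y\<close> with
  \<open>T x y \<noteq> 0\<close> is annihilated by a power of \<open>c g - 1\<close>.  Then \<open>x \<times> y\<close> is annihilated by a power of
  \<open>g - 1\<close>, hence equal to a scalar \<open>d 1\<close>.  If \<open>x\<^sup># = 0\<close>, then \<open>d\<^sup>2 1 = (x \<times> y)\<^sup>#\<close> is a multiple of the
  trace-zero element \<open>x\<close>, so \<open>d = 0\<close>; but the trace of \<open>x \<times> y\<close> is \<open>- T x y\<close>.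
\<close>

lemma eigenvector_sharp_nonzero:
  assumes x: "x \<noteq> 0" "T x one = 0" and eig: "g x = scale c x"
  shows "sharp x \<noteq> 0"
proof
  assume sharp_x: "sharp x = 0"
  define h where "h y = scale c (g y) - y" for y
  have "Vector_Spaces.linear scale scale h"
    by unfold_locales (simp_all add: h_def g.add g.scale algebra_simps)
  then interpret h: linear_operator scale h
    by (intro linear_operator.intro linear_operator_axioms.intro vector_space_axioms)
  have h_T: "T x (h y) = 0" for y
    using g_T[of x y] by (simp add: h_def T_simps eig)
  have h_cross: "cross x (h y) = g (cross x y) - cross x y" for y
    by (simp add: h_def cross_simps g_cross eig)
  have h_cross_pow: "cross x ((h ^^ n) y) = ((\<lambda>x. g x - x) ^^ n) (cross x y)" for n y
    by (induction n) (simp_all add: h_cross)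
  obtain y0 where "T x y0 \<noteq> 0" using T_nondegenerate x by blast
  moreover obtain B where B: "finite B" "span B = UNIV" using finite_span by blast
  ultimately obtain y n where y: "(h ^^ n) y = 0" "T x y \<noteq> 0"
    using h.nilpotent_vector_with_nonzero_value[OF B linear_T_right h_T] by metis
  have "((\<lambda>x. g x - x) ^^ n) (cross x y) = 0"
    using h_cross_pow[of n y] y by (simp add: cross_simps)
  then obtain d where d: "cross x y = scale d one" by (rule eventually_fixed_imp_scalar)
  obtain u :: 'a where "u \<noteq> 0" "u \<noteq> 1" using exists_scalar_not_0_1 by blast
  then have "scale (d\<^sup>2) one = scale (T x (sharp y)) x"
    using sharp_cross_of_sharp_zero[of u x y] sharp_x d by (simp add: sharp_scale sharp_one)
  then have "T (scale (d\<^sup>2) one) one = 0" using x by (simp add: T_simps)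
  then have "d = 0" using three_nonzero by (simp add: T_simps T_one_one)
  then have "T (cross x y) one = 0" using d by (simp add: T_simps)
  then show False using T_cross_one[of x y] x y by (simp add: cross_def)
qed

text \<open>
  If \<open>N x = 0\<close>, then \<open>x\<^sup>#\<close> is an eigenvector with \<open>x\<^sup>#\<^sup># = N(x) x = 0\<close>, and the preceding lemma applies
  to it when it has trace zero.  Otherwise its eigenvalue is 1 and it is a scalar.
\<close>

lemma eigenvector_norm_nonzero:
  assumes x: "x \<noteq> 0" "T x one = 0" and eig: "g x = scale c x"
  shows "N x \<noteq> 0"
proof
  assume "N x = 0"
  then have ss: "sharp (sharp x) = 0" using sharp_sharp by simp
  have s0: "sharp x \<noteq> 0" using eigenvector_sharp_nonzero assms by blast
  have eig2: "g (sharp x) = scale (c\<^sup>2) (sharp x)" by (simp add: g_sharp eig sharp_scale)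
  show False
  proof (cases "T (sharp x) one = 0")
    case True
    then show False using eigenvector_sharp_nonzero[OF s0 _ eig2] ss by blast
  next
    case False
    then have "c\<^sup>2 = 1" using trace_g[of "sharp x"] by (simp add: eig2 T_simps)
    then have "g (sharp x) = sharp x" by (simp add: eig2)
    then obtain d where d: "sharp x = scale d one" by (rule fixed_imp_scalar)
    then have "d\<^sup>2 = 0" using ss one_nonzero three_nonzero by (simp add: sharp_scale sharp_one)
    then show False using d s0 by simp
  qed
qed

text \<open>
  Applying \<open>g\<close> to \<open>x\<^sup>#\<^sup># = N(x) x\<close> gives \<open>c\<^sup>4 = c\<close>.
\<close>

lemma eigenvalue_primitive_cube_root:
  assumes x: "x \<noteq> 0" "T x one = 0" and eig: "g x = scale c x"
  shows "c\<^sup>2 + c + 1 = 0"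
proof -
  have c0: "c \<noteq> 0" using g_inj x eig by auto
  have c1: "c \<noteq> 1" using no_fixed_trace_zero x eig by auto
  have "scale (c * N x) x = g (sharp (sharp x))" by (simp add: sharp_sharp g.scale eig mult.commute)
  also have "\<dots> = sharp (sharp (scale c x))" by (simp only: g_sharp eig)
  also have "\<dots> = scale (c ^ 4 * N x) x"
    by (simp add: sharp_scale sharp_sharp flip: power_mult)
  finally have "c * N x = c ^ 4 * N x" by (rule scale_right_imp_eq[OF x(1)])
  then have "c ^ 4 * N x - c * N x = 0" by (simp only: diff_self)
  moreover have "(c * (c - 1) * (c\<^sup>2 + c + 1)) * N x = c ^ 4 * N x - c * N x"
    by (simp add: algebra_simps power2_eq_square power4_eq_xxxx)
  ultimately have "(c * (c - 1) * (c\<^sup>2 + c + 1)) * N x = 0" by (simp only:)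
  then show ?thesis using c0 c1 eigenvector_norm_nonzero[OF assms] by simp
qed

text \<open>
  Invariance of the pairing of \<open>x\<^sup>#\<close> with \<open>v\<close> would force \<open>T x\<^sup># x = 3 N(x)\<close> to vanish.
\<close>

lemma no_jordan_block:
  assumes x: "x \<noteq> 0" "T x one = 0" and eig: "g x = scale c x"
  shows "g v \<noteq> scale c v + x"
proof
  assume v: "g v = scale c v + x"
  have c: "c\<^sup>2 + c + 1 = 0" by (rule eigenvalue_primitive_cube_root[OF assms])
  have "c\<^sup>2 * c - 1 = (c - 1) * (c\<^sup>2 + c + 1)"
    by (simp add: algebra_simps power2_eq_square)
  then have c3: "c\<^sup>2 * c = 1" by (simp add: c)
  then have c0: "c \<noteq> 0" by (intro notI) simp
  have "T (sharp x) v = T (g (sharp x)) (g v)" by (simp add: g_T)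
  also have "\<dots> = c\<^sup>2 * c * T (sharp x) v + c\<^sup>2 * T (sharp x) x"
    unfolding g_sharp eig v sharp_scale T_scale T_add
    by (simp only: distrib_left ac_simps)
  also have "\<dots> = T (sharp x) v + c\<^sup>2 * T (sharp x) x" unfolding c3 by simp
  finally have "c\<^sup>2 * T (sharp x) x = 0" by (simp only: add_cancel_right_right)
  then have "T (sharp x) x = 0" using c0 by simp
  then show False
    using T_sharp_self[of x] three_nonzero eigenvector_norm_nonzero assms by simp
qed

text \<open>
  Every eigenvalue on the trace-zero elements is a root of \<open>X\<^sup>2 + X + 1\<close>.  If \<open>g\<^sup>2 + g + 1\<close> did not
  vanish there, its image would contain an eigenvector, and undoing one of the two linear factors of
  \<open>X\<^sup>2 + X + 1\<close> would exhibit a Jordan block.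
\<close>

lemma cubic_relation_on_trace_zero:
  assumes v: "T v one = 0"
  shows "g (g v) + g v + v = 0"
proof (rule ccontr)
  define h where "h v = g (g v) + g v + v" for v
  assume "g (g v) + g v + v \<noteq> 0"
  then have hv: "h v \<noteq> 0" by (simp add: h_def)
  have h_lin: "h (scale c x) = scale c (h x)" "h (x + y) = h x + h y" "g (h x) = h (g x)" for c x y
    by (simp_all add: h_def g.add g.scale algebra_simps)
  obtain B where B: "finite B" "span B = UNIV" using finite_span by blast
  let ?W = "{h u |u. T u one = 0}"
  have "subspace ?W"
  proof (rule subspaceI)
    have "h 0 = 0" by (simp add: h_def)
    then show "0 \<in> ?W" by (intro CollectI exI[of _ 0]) (simp add: T_simps)
    show "x + y \<in> ?W" if xy: "x \<in> ?W" "y \<in> ?W" for x y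
    proof -
      obtain u v where "x = h u" "T u one = 0" "y = h v" "T v one = 0" using xy by blast
      then have "x + y = h (u + v)" "T (u + v) one = 0" by (simp_all add: h_lin T_simps)
      then show ?thesis by blast
    qed
    show "scale a x \<in> ?W" if x: "x \<in> ?W" for a x
    proof -
      obtain u where "x = h u" "T u one = 0" using x by blast
      then have "scale a x = h (scale a u)" "T (scale a u) one = 0" by (simp_all add: h_lin T_simps)
      then show ?thesis by blast
    qed
  qed
  moreover have "g ` ?W \<subseteq> ?W"
  proof clarify
    fix u assume "T u one = 0"
    then have "g (h u) = h (g u)" "T (g u) one = 0" by (simp_all add: h_lin trace_g)
    then show "\<exists>u'. g (h u) = h u' \<and> T u' one = 0" by blast
  qed
  moreover have "h v \<in> ?W" using v by blast
  ultimately obtain x c where x: "x \<in> ?W" "x \<noteq> 0" and eig: "g x = scale c x"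
    by (rule eigenvector_exists[OF roots B _ _ _ hv])
  then obtain u where u: "x = h u" "T u one = 0" by blast
  have tx: "T x one = 0" using u by (simp add: h_def T_simps trace_g)
  have c: "c\<^sup>2 + c + 1 = 0" using eigenvalue_primitive_cube_root[OF x(2) tx eig] .
  define d where "d = - 1 - c"
  have cd: "c * d = 1" unfolding d_def by (rule primitive_cube_root_simps(1)[OF c])
  have "g (g u - scale d u) = scale c (g u - scale d u) + x"
  proof -
    have "scale c (g u - scale d u) + x = g (g u) + scale (c + 1) (g u) + (u - scale (c * d) u)"
      unfolding u(1) h_def by (simp add: scale_right_diff_distrib scale_left_distrib)
    also have "\<dots> = g (g u) + scale (- d) (g u)" unfolding cd by (simp add: d_def)
    also have "\<dots> = g (g u - scale d u)" by (simp add: g.diff g.scale)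
    finally show ?thesis by (rule sym)
  qed
  then show False using no_jordan_block[OF x(2) tx eig] by blast
qed

text \<open>
  Up to a scalar, \<open>e\<close> is the difference of eigenvectors \<open>a\<close> and \<open>b\<close> for the two primitive cube roots
  of unity \<open>c\<close> and \<open>d\<close>.  In \<open>0 = (a - b)\<^sup># = a\<^sup># - a \<times> b + b\<^sup>#\<close> the three terms belong to the distinct
  eigenvalues \<open>c\<^sup>2 = d\<close>, \<open>c d = 1\<close> and \<open>d\<^sup>2 = c\<close>.  So they all vanish, but eigenvectors of trace zero have
  nonzero adjoint.
\<close>

theorem trace_zero_sharp_zero_imp_zero:
  assumes "T e one = 0" "sharp e = 0"
  shows "e = 0"
proof -
  from primitive_cube_root_exists obtain c :: 'a where c: "c\<^sup>2 + c + 1 = 0" ..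
  define d where "d = - 1 - c"
  have cd: "c * d = 1" unfolding d_def by (rule primitive_cube_root_simps(1)[OF c])
  have c2: "c\<^sup>2 = d" unfolding d_def by (rule primitive_cube_root_simps(2)[OF c])
  have d2: "d\<^sup>2 = c" unfolding d_def by (rule primitive_cube_root_simps(3)[OF c])
  have dc: "d \<noteq> c"
  proof
    assume "d = c"
    moreover have "c + d + 1 = 0" by (simp add: d_def)
    ultimately have "c + c + 1 = 0" by simp
    moreover have "4 * (c\<^sup>2 + c + 1) - (c + c + 1)\<^sup>2 = 3"
      by (simp add: algebra_simps power2_eq_square)
    ultimately have "(3::'a) = 0" using c by simp
    then show False using three_nonzero by simp
  qed
  have c1: "c \<noteq> 1" and d1: "d \<noteq> 1" using c2 d2 dc by fastforce+
  define a where "a = g e - scale d e"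
  define b where "b = g e - scale c e"
  have gge: "g (g e) = - (g e + e)"
    using cubic_relation_on_trace_zero[OF assms(1)] by (simp only: eq_neg_iff_add_eq_0 add.assoc)
  have split: "g (g e - scale r e) = scale s (g e - scale r e)" if "s * r = 1" "s = - 1 - r" for r s
  proof -
    have "g (g e - scale r e) = scale (- 1 - r) (g e) - scale 1 e"
      by (simp add: g.diff g.scale gge scale_left_diff_distrib)
    also have "\<dots> = scale s (g e) - scale (s * r) e" by (simp only: that(1) flip: that(2))
    finally show ?thesis by (simp add: scale_right_diff_distrib)
  qed
  have "c = - 1 - d" by (simp add: d_def)
  then have ga: "g a = scale c a" unfolding a_def by (rule split[OF cd])
  have "d * c = 1" using cd by (simp only: mult.commute)
  then have gb: "g b = scale d b" unfolding b_def using d_def by (rule split)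
  have ab: "T a one = 0" "T b one = 0" by (simp_all add: a_def b_def T_simps trace_g assms)
  have eab: "scale (c - d) e = a - b" by (simp add: a_def b_def scale_left_diff_distrib)
  have "sharp (a - b) = 0" using assms(2) by (simp add: sharp_scale flip: eab)
  then have s: "cross a b = sharp a + sharp b"
    using sharp_add[of a "- b"] sharp_scale[of "- 1" b] by (simp add: cross_simps algebra_simps)
  have gab: "g (sharp a) = scale d (sharp a)" "g (sharp b) = scale c (sharp b)"
    by (simp_all add: g_sharp ga gb sharp_scale c2 d2)
  have "g (cross a b) = cross a b"
    by (simp add: g_cross ga gb cross_simps cd mult.commute[of d c])
  then have 1: "scale (d - 1) (sharp a) = scale (1 - c) (sharp b)"
    by (simp add: s g.add gab scale_left_diff_distrib algebra_simps)
  then have "g (scale (d - 1) (sharp a)) = g (scale (1 - c) (sharp b))" by simp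
  then have "scale d (scale (d - 1) (sharp a)) = scale c (scale (1 - c) (sharp b))"
    by (simp add: g.scale gab mult.commute)
  then have "scale (d - c) (scale (1 - c) (sharp b)) = 0"
    unfolding 1 by (simp add: scale_left_diff_distrib)
  then have "sharp b = 0" using dc c1 by simp
  then have "sharp a = 0" using 1 d1 by simp
  then have "a = 0" "b = 0"
    using \<open>sharp b = 0\<close> eigenvector_sharp_nonzero ab ga gb by blast+
  then have "scale (c - d) e = 0" using eab by simp
  then show ?thesis using dc by simp
qed

end

section \<open>The split structure is a cubic norm structure\<close>

text \<open>
  The bilinear map attached to the quadratic map \<^const>\<open>adjugate3\<close>.
\<close>

definition adjugate3_polar :: "'r::comm_ring_1^3^3 \<Rightarrow> 'r^3^3 \<Rightarrow> 'r^3^3"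
  where "adjugate3_polar x y = (\<chi> i j.
    x $ (j + 1) $ (i + 1) * y $ (j + 2) $ (i + 2) + y $ (j + 1) $ (i + 1) * x $ (j + 2) $ (i + 2)
    - x $ (j + 1) $ (i + 2) * y $ (j + 2) $ (i + 1) - y $ (j + 1) $ (i + 2) * x $ (j + 2) $ (i + 1))"

lemma adjugate3_add: "adjugate3 (x + y) = adjugate3 x + adjugate3_polar x y + adjugate3 y"
  by (simp add: adjugate3_def adjugate3_polar_def vec_eq_iff algebra_simps)

lemma adjugate3_diff: "adjugate3 (x - y) = adjugate3 x - adjugate3_polar x y + adjugate3 y"
  by (simp add: adjugate3_def adjugate3_polar_def vec_eq_iff algebra_simps)

lemma adjugate3_polar_add:
  "adjugate3_polar (x + x') y = adjugate3_polar x y + adjugate3_polar x' y"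
  "adjugate3_polar x (y + y') = adjugate3_polar x y + adjugate3_polar x y'"
  by (simp_all add: adjugate3_polar_def vec_eq_iff algebra_simps)

lemma map_matrix_times_simps:
  fixes c :: "'r::comm_ring_1"
  shows "map_matrix ((*) c) (x + y) = map_matrix ((*) c) x + map_matrix ((*) c) y"
    and "map_matrix ((*) c) (x - y) = map_matrix ((*) c) x - map_matrix ((*) c) y"
    and "map_matrix ((*) (c + d)) x = map_matrix ((*) c) x + map_matrix ((*) d) x"
    and "map_matrix ((*) (c - d)) x = map_matrix ((*) c) x - map_matrix ((*) d) x"
    and "map_matrix ((*) c) (map_matrix ((*) d) x) = map_matrix ((*) (c * d)) x"
    and "map_matrix ((*) 1) x = x"
    and "map_matrix ((*) c) 0 = 0"
  by (simp_all add: vec_eq_iff algebra_simps)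

lemma map_matrix_times_mult:
  fixes c :: "'r::comm_ring_1" and x :: "'r^'n^'m" and y :: "'r^'p^'n"
  shows "map_matrix ((*) c) x ** y = map_matrix ((*) c) (x ** y)"
    and "x ** map_matrix ((*) c) y = map_matrix ((*) c) (x ** y)"
  by (simp_all add: vec_eq_iff matrix_matrix_mult_def sum_distrib_left algebra_simps)

lemma trace_map_matrix_times: "trace (map_matrix ((*) c) x) = (c::'r::comm_ring_1) * trace x"
  by (simp add: trace_def sum_distrib_left)

lemma mat_mult: "mat c ** x = map_matrix ((*) c) x"
  for c :: "'r::comm_ring_1" and x :: "'r^'n^'n"
  by (simp add: vec_eq_iff matrix_matrix_mult_def mat_def if_distrib[of "\<lambda>a. a * _"] cong: if_cong)

lemma adjugate3_scale:
  "adjugate3 (map_matrix ((*) c) x) = map_matrix ((*) (c\<^sup>2)) (adjugate3 x)"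
  "adjugate3_polar (map_matrix ((*) c) x) y = map_matrix ((*) c) (adjugate3_polar x y)"
  "adjugate3_polar x (map_matrix ((*) c) y) = map_matrix ((*) c) (adjugate3_polar x y)"
  by (simp_all add: adjugate3_def adjugate3_polar_def vec_eq_iff algebra_simps power2_eq_square)

lemma det_scale3: "det (map_matrix ((*) c) x) = c ^ 3 * det (x :: 'r::comm_ring_1^3^3)"
  by (simp add: det_3 algebra_simps power3_eq_cube)

lemma numerals_mod_3: "(4::3) = 1" "(5::3) = 2" "(6::3) = 3"
  by simp_all

lemma det_add3:
  fixes x y :: "'r::comm_ring_1^3^3"
  shows "det (x + y) = det x + trace (adjugate3 x ** y) + trace (x ** adjugate3 y) + det y"
  by (simp add: det_3 trace_def adjugate3_def matrix_matrix_mult_def sum_3 numerals_mod_3 algebra_simps)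

lemma adjugate3_mul:
  fixes x y :: "'r::comm_ring_1^3^3"
  shows "adjugate3 (x ** y) = adjugate3 y ** adjugate3 x"
  by (simp add: adjugate3_def matrix_matrix_mult_def vec_eq_iff forall_3 sum_3 numerals_mod_3
      algebra_simps)

lemma adjugate3_adjugate3:
  fixes x :: "'r::comm_ring_1^3^3"
  shows "adjugate3 (adjugate3 x) = map_matrix ((*) (det x)) x"
  by (simp add: adjugate3_def det_3 vec_eq_iff forall_3 numerals_mod_3 algebra_simps)

text \<open>
  This is the identity \<open>x y x = T(x, y) x - x\<^sup># \<times> y\<close> for the quadratic operator of the Jordan algebra
  of \<open>3 \<times> 3\<close> matrices.
\<close>

lemma adjugate3_polar_adjugate3:
  fixes x y :: "'r::comm_ring_1^3^3"
  shows "adjugate3_polar (adjugate3 x) y = map_matrix ((*) (trace (x ** y))) x - x ** y ** x"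
  by (simp add: adjugate3_def adjugate3_polar_def trace_def matrix_matrix_mult_def vec_eq_iff
      forall_3 sum_3 numerals_mod_3 algebra_simps)

lemma trace_adjugate3_polar:
  fixes x y :: "'r::comm_ring_1^3^3"
  shows "trace (adjugate3_polar x y) = trace x * trace y - trace (x ** y)"
  by (simp add: adjugate3_polar_def trace_def matrix_matrix_mult_def sum_3 numerals_mod_3
      algebra_simps)

lemma adjugate3_mat_1: "adjugate3 (mat 1) = mat 1"
  by (simp add: adjugate3_def mat_def vec_eq_iff forall_3 numerals_mod_3)

lemma matrix_add_right_distrib: "(a + b) ** c = a ** c + b ** c"
  for a b :: "'r::comm_ring_1^'n^'m" and c :: "'r^'p^'n"
  by (simp add: matrix_matrix_mult_def vec_eq_iff sum.distrib distrib_right)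

lemma matrix_diff_distrib:
  fixes a b :: "'r::comm_ring_1^'n^'m" and c :: "'r^'p^'n"
  shows "(a - b) ** c = a ** c - b ** c" and "d ** (a - b) = d ** a - d ** b"
  by (simp_all add: matrix_matrix_mult_def vec_eq_iff sum_subtractf left_diff_distrib
      right_diff_distrib)

lemma trace_rotate: "trace (x ** y ** z) = trace (y ** z ** (x :: 'r::comm_ring_1^'n^'n))"
  by (metis matrix_mul_assoc trace_mul_sym)

lemma vector_space_times: "vector_space ((*) :: 'k::field \<Rightarrow> 'k \<Rightarrow> 'k)"
  by unfold_locales (simp_all add: algebra_simps)

lemma vector_space_J_smult:
  "vector_space (J_smult :: 'k::field \<Rightarrow> 'k mat3_triple \<Rightarrow> 'k mat3_triple)"
  by unfold_locales (auto simp: map_matrix_times_simps)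

lemma linear_from_J:
  assumes "vector_space s" and "\<And>x y. f (x + y) = f x + f y" and "\<And>c x. f (J_smult c x) = s c (f x)"
  shows "Vector_Spaces.linear J_smult s f"
  using assms vector_space_J_smult
  by (simp add: Vector_Spaces.linear_iff)

fun J_cross :: "'r::comm_ring_1 mat3_triple \<Rightarrow> 'r mat3_triple \<Rightarrow> 'r mat3_triple"
  where "J_cross (x\<^sub>0, x\<^sub>1, x\<^sub>2) (y\<^sub>0, y\<^sub>1, y\<^sub>2) =
    (adjugate3_polar x\<^sub>0 y\<^sub>0 - x\<^sub>1 ** y\<^sub>2 - y\<^sub>1 ** x\<^sub>2,
     adjugate3_polar x\<^sub>2 y\<^sub>2 - x\<^sub>0 ** y\<^sub>1 - y\<^sub>0 ** x\<^sub>1,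
     adjugate3_polar x\<^sub>1 y\<^sub>1 - x\<^sub>2 ** y\<^sub>0 - y\<^sub>2 ** x\<^sub>0)"

lemma J_adj_polar: "J_adj (x + y) - J_adj x - J_adj y = J_cross x y"
  by (cases x; cases y)
    (simp add: adjugate3_add matrix_add_ldistrib matrix_add_right_distrib algebra_simps)

lemma quadratic_map_J_adj:
  "quadratic_map J_smult J_smult (J_adj :: 'k::field mat3_triple \<Rightarrow> 'k mat3_triple)"
  unfolding quadratic_map_def bilinear_map_def J_adj_polar
proof (intro conjI allI linear_from_J vector_space_J_smult)
  fix c :: 'k and x y z :: "'k mat3_triple"
  show "J_adj (J_smult c x) = J_smult (c\<^sup>2) (J_adj x)"
    by (cases x) (simp add: adjugate3_scale map_matrix_times_mult map_matrix_times_simps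
        power2_eq_square)
  show "J_cross x (y + z) = J_cross x y + J_cross x z"
    "J_cross (x + y) z = J_cross x z + J_cross y z"
    by (cases x; cases y; cases z;
        simp add: adjugate3_polar_add matrix_add_ldistrib matrix_add_right_distrib algebra_simps)+
  show "J_cross x (J_smult c y) = J_smult c (J_cross x y)"
    "J_cross (J_smult c x) y = J_smult c (J_cross x y)"
    by (cases x; cases y;
        simp add: adjugate3_scale map_matrix_times_mult map_matrix_times_simps)+
qed

lemma bilinear_map_J_trace_form: "bilinear_map J_smult (*) (J_trace_form :: 'k::field mat3_triple \<Rightarrow> _)"
  unfolding bilinear_map_def
proof (intro conjI allI linear_from_J vector_space_times)
  fix c :: 'k and x y z :: "'k mat3_triple"
  show "J_trace_form x (y + z) = J_trace_form x y + J_trace_form x z"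
    "J_trace_form (x + y) z = J_trace_form x z + J_trace_form y z"
    by (cases x; cases y; cases z;
        simp add: matrix_add_ldistrib matrix_add_right_distrib trace_add algebra_simps)+
  show "J_trace_form x (J_smult c y) = c * J_trace_form x y"
    "J_trace_form (J_smult c x) y = c * J_trace_form x y"
    by (cases x; cases y;
        simp add: map_matrix_times_mult trace_map_matrix_times algebra_simps)+
qed

lemma J_trace_form_commute: "J_trace_form x y = J_trace_form y (x :: 'r::comm_ring_1 mat3_triple)"
proof -
  obtain a b c a' b' c' where xy: "x = (a, b, c)" "y = (a', b', c')" by (cases x; cases y)
  show ?thesis
    using trace_mul_sym[of a a'] trace_mul_sym[of b c'] trace_mul_sym[of c b'] by (simp add: xy)
qed

text \<open>
  Pairing with a matrix unit reads off an entry.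
\<close>

lemma trace_form_nondegenerate:
  fixes x :: "'r::comm_ring_1^3^3"
  assumes "\<And>y. trace (x ** y) = 0"
  shows "x = 0"
proof -
  have "x $ i $ j = trace (x ** (\<chi> k l. if k = j \<and> l = i then 1 else 0))" for i j
    using exhaust_3[of i] exhaust_3[of j]
    by (auto simp: trace_def matrix_matrix_mult_def sum_3)
  then show ?thesis using assms by (simp add: vec_eq_iff)
qed

lemma J_trace_form_nondegenerate:
  fixes x :: "'r::comm_ring_1 mat3_triple"
  assumes "\<And>y. J_trace_form x y = 0"
  shows "x = 0"
proof -
  obtain a b c where x: "x = (a, b, c)" by (cases x)
  have "trace (a ** y) = 0" "trace (b ** y) = 0" "trace (c ** y) = 0" for y
    using assms[of "(y, 0, 0)"] assms[of "(0, 0, y)"] assms[of "(0, y, 0)"]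
    by (simp_all add: x trace_0[unfolded mat_0])
  then show ?thesis using trace_form_nondegenerate by (auto simp: x zero_prod_def)
qed

lemma J_norm_scale: "J_norm (J_smult c x) = c ^ 3 * J_norm (x :: 'r::comm_ring_1 mat3_triple)"
  by (cases x) (simp add: det_scale3 map_matrix_times_mult trace_map_matrix_times
      map_matrix_times_simps power3_eq_cube algebra_simps)

lemma J_norm_add:
  "J_norm (x + y) = J_norm x + J_trace_form (J_adj x) y + J_trace_form x (J_adj y) +
    J_norm (y :: 'r::comm_ring_1 mat3_triple)"
proof -
  obtain a b c a' b' c' where xy: "x = (a, b, c)" "y = (a', b', c')" by (cases x; cases y)
  have "trace (b ** c ** a') = trace (a' ** b ** c)" "trace (c ** a ** b') = trace (a ** b' ** c)"
    "trace (b ** c' ** a') = trace (a' ** b ** c')" "trace (c ** a' ** b') = trace (a' ** b' ** c)"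
    by (rule trace_rotate[symmetric] trace_rotate)+
  note rot = this
  have sym: "trace (z ** adjugate3 w) = trace (adjugate3 w ** z)" for z w :: "'r^3^3"
    by (rule trace_mul_sym)
  show ?thesis
    by (simp only: xy add_Pair J_norm.simps J_adj.simps J_trace_form.simps det_add3
        matrix_add_ldistrib matrix_add_right_distrib matrix_diff_distrib trace_add trace_sub
        matrix_mul_assoc sym rot) simp
qed

lemma J_trace_form_adj_self: "J_trace_form (J_adj x) x = 3 * J_norm (x :: 'r::comm_ring_1 mat3_triple)"
proof -
  obtain a b c where x: "x = (a, b, c)" by (cases x)
  have "trace (adjugate3 z ** z) = 3 * det z" for z :: "'r^3^3"
    by (simp add: adjugate3_mult trace_def mat_def sum_3)
  moreover have "trace (b ** c ** a) = trace (a ** b ** c)" "trace (c ** a ** b) = trace (a ** b ** c)"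
    by (rule trace_rotate[symmetric] trace_rotate)+
  ultimately show ?thesis
    by (simp add: x matrix_diff_distrib trace_sub algebra_simps)
qed

lemma mult_mat: "x ** mat c = map_matrix ((*) c) x"
  for c :: "'r::comm_ring_1" and x :: "'r^'n^'n"
  by (metis mat_mult map_matrix_times_mult(2) map_matrix_times_simps(6) matrix_mul_rid)

text \<open>
  The adjoint identity in one component; the components of \<^const>\<open>J_adj\<close> are permuted cyclically, so
  the other two are instances.  All products of degree 4 cancel except those collected in the norm.
\<close>

lemma adj_adj_component:
  fixes x y z :: "'r::comm_ring_1^3^3"
  shows "adjugate3 (adjugate3 x - y ** z) - (adjugate3 z - x ** y) ** (adjugate3 y - z ** x) =
    map_matrix ((*) (det x + det y + det z - trace (x ** y ** z))) x"
proof -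
  have "adjugate3 (adjugate3 x - y ** z) = map_matrix ((*) (det x)) x -
      (map_matrix ((*) (trace (x ** y ** z))) x - x ** y ** z ** x) + adjugate3 z ** adjugate3 y"
    by (simp only: adjugate3_diff adjugate3_adjugate3 adjugate3_polar_adjugate3 adjugate3_mul
        matrix_mul_assoc)
  moreover have "adjugate3 z ** (z ** x) = map_matrix ((*) (det z)) x"
    by (simp only: matrix_mul_assoc adjugate3_mult mat_mult)
  moreover have "(x ** y) ** adjugate3 y = map_matrix ((*) (det y)) x"
    by (simp only: adjugate3_mult mult_mat flip: matrix_mul_assoc)
  moreover have "(x ** y) ** (z ** x) = x ** y ** z ** x" by (simp only: matrix_mul_assoc)
  ultimately show ?thesis
    by (simp only: matrix_diff_distrib map_matrix_times_simps) (simp add: algebra_simps)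
qed

lemma J_adj_J_adj: "J_adj (J_adj x) = J_smult (J_norm x) (x :: 'r::comm_ring_1 mat3_triple)"
proof -
  obtain a b c where x: "x = (a, b, c)" by (cases x)
  have rot: "trace (b ** c ** a) = trace (a ** b ** c)" "trace (c ** a ** b) = trace (a ** b ** c)"
    by (rule trace_rotate[symmetric] trace_rotate)+
  have "det b + det c + det a = det a + det b + det c" "det c + det a + det b = det a + det b + det c"
    by simp_all
  then show ?thesis
    by (simp only: x J_adj.simps J_smult.simps J_norm.simps adj_adj_component rot)
qed

lemma mult_zero_matrix:
  fixes x :: "'r::comm_ring_1^'n^'m"
  shows "x ** (0 :: 'r^'p^'n) = 0" and "(0 :: 'r^'m^'p) ** x = 0"
  by (simp_all add: matrix_matrix_mult_def vec_eq_iff)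

lemma adjugate3_0: "adjugate3 0 = 0"
  by (simp add: adjugate3_def vec_eq_iff)

lemma J_adj_one: "J_adj (mat 1, 0, 0) = (mat 1, 0, 0)"
  by (simp add: adjugate3_mat_1 adjugate3_0 mult_zero_matrix)

lemma J_trace_form_one: "J_trace_form (x\<^sub>0, x\<^sub>1, x\<^sub>2) (mat 1, 0, 0) = trace x\<^sub>0"
  by (simp add: mult_zero_matrix trace_def)

lemma trace_J_cross:
  "J_trace_form (J_cross x y) (mat 1, 0, 0) =
    J_trace_form x (mat 1, 0, 0) * J_trace_form y (mat 1, 0, 0) - J_trace_form x y"
proof -
  obtain a b c a' b' c' where xy: "x = (a, b, c)" "y = (a', b', c')" by (cases x; cases y)
  show ?thesis
    using trace_mul_sym[of b' c]
    by (simp add: xy J_trace_form_one trace_sub trace_adjugate3_polar del: J_trace_form.simps)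
      (simp add: algebra_simps)
qed

lemma cubic_norm_structure_J:
  "cubic_norm_structure (J_smult :: 'k::field \<Rightarrow> _) (mat 1, 0, 0) J_norm J_adj J_trace_form"
proof (intro cubic_norm_structure.intro cubic_norm_structure_axioms.intro vector_space_J_smult)
  show "J_trace_form (mat 1, 0, 0) (mat 1, 0, 0) = (3 :: 'k)"
    by (simp only: J_trace_form_one trace_I) simp
qed (auto simp: bilinear_map_J_trace_form quadratic_map_J_adj J_norm_scale J_norm_add
    J_trace_form_adj_self J_adj_J_adj J_adj_one J_adj_polar trace_J_cross
    intro: J_trace_form_commute J_trace_form_nondegenerate simp del: J_adj.simps)

section \<open>Extension of automorphisms and descent of fixed vectors\<close>

lemma field_extension_simps:
  assumes "field_extension \<kappa>"
  shows "\<kappa> 0 = 0" "\<kappa> 1 = 1" "\<kappa> (a + b) = \<kappa> a + \<kappa> b" "\<kappa> (a * b) = \<kappa> a * \<kappa> b"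
    "\<kappa> (a - b) = \<kappa> a - \<kappa> b" "\<kappa> a = 0 \<longleftrightarrow> a = 0"
proof -
  show add: "\<kappa> (a + b) = \<kappa> a + \<kappa> b" and mult: "\<kappa> (a * b) = \<kappa> a * \<kappa> b" and one: "\<kappa> 1 = 1" for a b
    using assms by (simp_all add: field_extension_def)
  show zero: "\<kappa> 0 = 0" using add[of 0 0] by (simp only: add_0_right add_cancel_right_right)
  show "\<kappa> (a - b) = \<kappa> a - \<kappa> b" using add[of "a - b" b] by simp
  show "\<kappa> a = 0 \<longleftrightarrow> a = 0"
    using mult[of a "inverse a"] one zero by (cases "a = 0") auto
qed

text \<open>
  The map \<open>h\<close> plays the role of \<open>x \<mapsto> x \<otimes> 1\<close> for the field extension \<open>\<kappa>\<close>.  Instead of sending a basis to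
  a basis, its range is only required to span; nondegeneracy of the trace form replaces independence.
\<close>

locale cubic_space_embedding =
  cubic_norm_structure scale one N sharp T
  for scale :: "'l::field \<Rightarrow> 'v::ab_group_add \<Rightarrow> 'v" and one N sharp T +
  fixes \<kappa> :: "'k::field \<Rightarrow> 'l" and A :: "('k, 'a::ab_group_add) cubic_space" and h :: "'a \<Rightarrow> 'v"
  assumes cubic_space: "cubic_space A"
    and extension: "field_extension \<kappa>"
    and h_add: "h (x + y) = h x + h y"
    and h_smult: "h (smult A c x) = scale (\<kappa> c) (h x)"
    and h_unit: "h (unit A) = one"
    and h_adj: "h (adj A x) = sharp (h x)"
    and T_h: "T (h x) (h y) = \<kappa> (trace_form A x y)"
    and span_range_h: "span (range h) = UNIV"
begin

lemma vector_space_A: "vector_space (smult A)"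
  using cubic_space by (simp add: cubic_space_def)

lemma h_zero: "h 0 = 0"
  using h_add[of 0 0] by simp

lemma h_diff: "h (x - y) = h x - h y"
  using h_add[of "x - y" y] by simp

lemma span_image_h:
  assumes "module.span (smult A) B = UNIV"
  shows "span (h ` B) = UNIV"
proof -
  interpret A: vector_space "smult A" by (rule vector_space_A)
  have "A.subspace {x. h x \<in> span (h ` B)}"
    by (rule A.subspaceI) (auto simp: h_zero h_add h_smult span_zero span_add span_scale)
  then have "A.span B \<subseteq> {x. h x \<in> span (h ` B)}"
    by (intro A.span_minimal) (auto intro: span_base)
  then have "range h \<subseteq> span (h ` B)" using assms by auto
  then show ?thesis using span_range_h span_minimal[OF _ subspace_span] by blast
qed

lemma linear_eq_if_eq_on_range:
  assumes "Vector_Spaces.linear scale s f" "Vector_Spaces.linear scale s g"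
    and "\<And>x. f (h x) = g (h x)"
  shows "f y = g y"
proof -
  interpret f: Vector_Spaces.linear scale s f by fact
  interpret g: Vector_Spaces.linear scale s g by fact
  have "subspace {y. f y = g y}"
    by (rule subspaceI) (auto simp: f.add g.add f.scale g.scale f.zero g.zero)
  then have "span (range h) \<subseteq> {y. f y = g y}"
    using assms(3) by (intro span_minimal) auto
  then show ?thesis using span_range_h by auto
qed

text \<open>
  Let \<open>\<psi>\<close> be the linear map prescribed on a basis contained in the range of \<open>h\<close>.  It satisfies
  \<open>T (\<psi> y) (h (\<phi> a)) = T y (h a)\<close> for basis vectors \<open>y\<close>, hence for all \<open>y\<close>.  As the elements \<open>h (\<phi> a)\<close>
  span, nondegeneracy of \<open>T\<close> then determines \<open>\<psi>\<close> on the whole range of \<open>h\<close>.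
\<close>

lemma linear_extension:
  assumes surj: "surj \<phi>"
    and isometry: "\<And>x y. trace_form A (\<phi> x) (\<phi> y) = trace_form A x y"
  obtains \<psi> where "Vector_Spaces.linear scale scale \<psi>" "\<forall>x. \<psi> (h x) = h (\<phi> x)"
proof -
  interpret vector_space_pair scale scale
    by (intro vector_space_pair.intro vector_space_axioms)
  obtain B where B: "B \<subseteq> range h" "independent B" "range h \<subseteq> span B"
    by (rule maximal_independent_subset)
  have span_B: "span B = UNIV"
    using span_range_h B(3) span_minimal[OF _ subspace_span] by blast
  obtain \<psi> where lin: "Vector_Spaces.linear scale scale \<psi>"
    and \<psi>: "\<forall>b\<in>B. \<psi> b = h (\<phi> (inv_into UNIV h b))"
    using linear_independent_extend[OF B(2), of "\<lambda>b. h (\<phi> (inv_into UNIV h b))"] by blast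
  interpret \<psi>: Vector_Spaces.linear scale scale \<psi> by (rule lin)
  have T_\<psi>: "T (\<psi> y) (h (\<phi> a)) = T y (h a)" for y a
  proof -
    have "subspace {y. T (\<psi> y) (h (\<phi> a)) = T y (h a)}"
      by (rule subspaceI) (auto simp: \<psi>.add \<psi>.scale \<psi>.zero T_simps)
    moreover have "B \<subseteq> {y. T (\<psi> y) (h (\<phi> a)) = T y (h a)}"
    proof
      fix b assume "b \<in> B"
      then have "h (inv_into UNIV h b) = b" using B(1) by (auto intro: f_inv_into_f)
      then have "T (\<psi> b) (h (\<phi> a)) = T b (h a)"
        using \<psi> \<open>b \<in> B\<close> isometry T_h by metis
      then show "b \<in> {y. T (\<psi> y) (h (\<phi> a)) = T y (h a)}" by simp
    qed
    ultimately have "span B \<subseteq> {y. T (\<psi> y) (h (\<phi> a)) = T y (h a)}" by (rule span_minimal[rotated])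
    then show ?thesis using span_B by blast
  qed
  have "\<psi> (h x) = h (\<phi> x)" for x
  proof -
    have "T (\<psi> (h x)) (h y) = T (h (\<phi> x)) (h y)" for y
    proof -
      obtain a where "y = \<phi> a" using surj by blast
      then show ?thesis by (simp add: T_\<psi> T_h isometry)
    qed
    then have "T (\<psi> (h x)) y = T (h (\<phi> x)) y" for y
      by (rule linear_eq_if_eq_on_range[OF linear_T_right linear_T_right])
    then have "T (\<psi> (h x) - h (\<phi> x)) y = 0" for y by (simp add: T_simps)
    then have "\<psi> (h x) - h (\<phi> x) = 0" by (rule T_nondegenerate)
    then show ?thesis by simp
  qed
  then show thesis using lin that by blast
qed

text \<open>
  The adjoint need not be tested on sums if its polarization is treated first: being compatible with
  the polarization on all pairs makes the set of \<open>y\<close> with \<open>\<psi> (y\<^sup>#) = (\<psi> y)\<^sup>#\<close> a subspace.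
\<close>

lemma extension_preserves:
  assumes \<phi>: "\<phi> \<in> Aut A"
    and lin: "Vector_Spaces.linear scale scale \<psi>" and \<psi>: "\<And>x. \<psi> (h x) = h (\<phi> x)"
  shows "\<psi> one = one" "T (\<psi> y) (\<psi> z) = T y z" "\<psi> (sharp y) = sharp (\<psi> y)"
proof -
  interpret \<psi>: Vector_Spaces.linear scale scale \<psi> by (rule lin)
  have \<phi>_one: "\<phi> (unit A) = unit A"
    and \<phi>_adj: "adj A (\<phi> x) = \<phi> (adj A x)"
    and \<phi>_T: "trace_form A (\<phi> x) (\<phi> y) = trace_form A x y" for x y
    using \<phi> by (auto simp: Aut_def cubic_space_iso_def)
  show "\<psi> one = one" using \<psi>[of "unit A"] by (simp add: \<phi>_one h_unit)
  have comp_right: "Vector_Spaces.linear scale s (\<lambda>z. f (\<psi> z))" if "Vector_Spaces.linear scale s f" for s f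
    using lin that by (simp add: Vector_Spaces.linear_iff)
  have comp_left: "Vector_Spaces.linear scale scale (\<lambda>z. \<psi> (f z))"
    if "Vector_Spaces.linear scale scale f" for f
    using lin that by (simp add: Vector_Spaces.linear_iff)
  have "T (\<psi> (h x)) (\<psi> (h a)) = T (h x) (h a)" for x a by (simp add: \<psi> T_h \<phi>_T)
  then have "T (\<psi> (h x)) (\<psi> z) = T (h x) z" for x z
    by (rule linear_eq_if_eq_on_range[OF comp_right[OF linear_T_right] linear_T_right])
  then show "T (\<psi> y) (\<psi> z) = T y z" for y z
    by (rule linear_eq_if_eq_on_range[OF comp_right[OF linear_T_left] linear_T_left])
  have \<psi>_sharp_h: "\<psi> (sharp (h x)) = sharp (\<psi> (h x))" for x
    by (simp add: \<psi> \<phi>_adj flip: h_adj)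
  have "\<psi> (cross (h x) (h a)) = cross (\<psi> (h x)) (\<psi> (h a))" for x a
    using \<psi>_sharp_h[of "x + a"] by (simp add: cross_def \<psi>.diff \<psi>.add \<psi>_sharp_h h_add)
  then have "\<psi> (cross (h x) z) = cross (\<psi> (h x)) (\<psi> z)" for x z
    by (rule linear_eq_if_eq_on_range[OF comp_left[OF linear_cross_right] comp_right[OF linear_cross_right]])
  then have \<psi>_cross: "\<psi> (cross y z) = cross (\<psi> y) (\<psi> z)" for y z
    by (rule linear_eq_if_eq_on_range[OF comp_left[OF linear_cross_left] comp_right[OF linear_cross_left]])
  have "subspace {y. \<psi> (sharp y) = sharp (\<psi> y)}"
    by (rule subspaceI) (auto simp: sharp_zero \<psi>.zero \<psi>.add \<psi>.scale sharp_add sharp_scale \<psi>_cross)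
  then have "span (range h) \<subseteq> {y. \<psi> (sharp y) = sharp (\<psi> y)}"
    using \<psi>_sharp_h by (intro span_minimal) auto
  then show "\<psi> (sharp y) = sharp (\<psi> y)" using span_range_h by auto
qed

text \<open>
  Having no nonzero fixed vector of trace zero means that \<open>g = \<phi> - 1 + T(\<cdot>, 1) 1\<close> is injective, for
  taking traces in \<open>g x = 0\<close> gives \<open>3 T(x, 1) = 0\<close>.  In finite dimension \<open>g\<close> is then surjective,
  and surjectivity passes to its extension \<open>G\<close>, which is therefore injective as well.
\<close>

lemma no_fixed_point_extends:
  assumes fin: "finite B" "module.independent (smult A) B" "module.span (smult A) B = UNIV"
    and three: "(3::'l) \<noteq> 0"
    and \<phi>: "\<phi> \<in> Aut A"
    and lin: "Vector_Spaces.linear scale scale \<psi>" and \<psi>: "\<And>x. \<psi> (h x) = h (\<phi> x)"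
    and free: "\<And>x. x \<in> trace_zero A \<Longrightarrow> \<phi> x = x \<Longrightarrow> x = 0"
    and y: "T y one = 0" "\<psi> y = y"
  shows "y = 0"
proof -
  interpret A: finite_dimensional_vector_space "smult A" B
    by (intro finite_dimensional_vector_space.intro vector_space_A
        finite_dimensional_vector_space_axioms.intro fin)
  obtain C where C: "C \<subseteq> h ` B" "independent C" "h ` B \<subseteq> span C"
    by (rule maximal_independent_subset)
  have "span C = UNIV"
    using span_image_h[OF fin(3)] C(3) span_minimal[OF _ subspace_span] by blast
  then interpret V: finite_dimensional_vector_space scale C
    by (intro finite_dimensional_vector_space.intro vector_space_axioms
        finite_dimensional_vector_space_axioms.intro C finite_subset[OF C(1)] finite_imageI fin(1))
  interpret \<psi>: Vector_Spaces.linear scale scale \<psi> by (rule lin)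
  have lin_\<phi>: "Vector_Spaces.linear (smult A) (smult A) \<phi>"
    and \<phi>_one: "\<phi> (unit A) = unit A"
    and \<phi>_T: "trace_form A (\<phi> x) (\<phi> y) = trace_form A x y" for x y
    using \<phi> by (auto simp: Aut_def cubic_space_iso_def)
  interpret \<phi>: Vector_Spaces.linear "smult A" "smult A" \<phi> by (rule lin_\<phi>)
  let ?t = "\<lambda>x. trace_form A x (unit A)"
  have "Vector_Spaces.linear (smult A) (*) ?t"
    using cubic_space by (simp add: cubic_space_def bilinear_map_def)
  then have t_add: "?t (x + y) = ?t x + ?t y" and t_smult: "?t (smult A c x) = c * ?t x" for c x y
    by (simp_all add: Vector_Spaces.linear_iff)
  have t_diff: "?t (x - y) = ?t x - ?t y" for x y using t_add[of "x - y" y] by simp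
  have t_\<phi>: "?t (\<phi> x) = ?t x" for x using \<phi>_T[of x "unit A"] by (simp add: \<phi>_one)
  have "\<kappa> (?t (unit A)) = 3" using T_one_one by (simp add: h_unit flip: T_h)
  then have t_unit: "?t (unit A) \<noteq> 0" using three field_extension_simps(1)[OF extension] by auto
  define g where "g x = \<phi> x - x + smult A (?t x) (unit A)" for x
  define G where "G y = \<psi> y - y + scale (T y one) one" for y
  have G_h: "G (h x) = h (g x)" for x
    by (simp add: G_def g_def \<psi> h_add h_diff h_smult T_h flip: h_unit)
  have lin_g: "Vector_Spaces.linear (smult A) (smult A) g"
    unfolding Vector_Spaces.linear_iff
    by (simp add: vector_space_A g_def \<phi>.add \<phi>.scale t_add t_smult A.scale_left_distrib
        A.scale_right_distrib A.scale_right_diff_distrib algebra_simps)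
  interpret g: Vector_Spaces.linear "smult A" "smult A" g by (rule lin_g)
  have "inj g"
  proof (rule injI)
    fix x y assume "g x = g y"
    then have g0: "g (x - y) = 0" by (simp add: g.diff)
    have "?t (g (x - y)) = ?t (x - y) * ?t (unit A)"
      unfolding g_def t_add t_smult t_diff t_\<phi> by simp
    moreover have "?t 0 = 0" using t_diff[of 0 0] by simp
    ultimately have t0: "?t (x - y) = 0" using t_unit g0 by simp
    then have fx: "\<phi> (x - y) = x - y" using g0 by (simp add: g_def)
    have "x - y \<in> trace_zero A" using t0 by (simp add: trace_zero_def)
    then have "x - y = 0" using fx by (rule free)
    then show "x = y" by simp
  qed
  then have "surj g" by (rule A.linear_inj_imp_surj[OF lin_g])
  have lin_G: "Vector_Spaces.linear scale scale G"
    unfolding Vector_Spaces.linear_iff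
    by (simp add: vector_space_axioms G_def \<psi>.add \<psi>.scale T_simps scale_left_distrib
        scale_right_distrib scale_right_diff_distrib algebra_simps)
  interpret G: Vector_Spaces.linear scale scale G by (rule lin_G)
  have "range h \<subseteq> range G" using \<open>surj g\<close> G_h by (metis image_subset_iff rangeI surjD)
  then have "surj G"
    using span_range_h span_minimal[OF _ G.subspace_image[OF subspace_UNIV]] by blast
  then have "inj G" by (rule V.linear_surj_imp_inj[OF lin_G])
  moreover have "G y = G 0" using y by (simp add: G_def T_zero)
  ultimately show ?thesis by (rule injD)
qed

theorem exists_fixed_trace_zero:
  assumes fin: "finite B" "module.independent (smult A) B" "module.span (smult A) B = UNIV"
    and roots: "\<forall>p :: 'l poly. degree p > 0 \<longrightarrow> (\<exists>r. poly p r = 0)"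
    and \<phi>: "\<phi> \<in> Aut A"
    and e: "e \<noteq> 0" "T e one = 0" "sharp e = 0"
  shows "\<exists>x\<in>trace_zero A. x \<noteq> 0 \<and> \<phi> x = x"
proof (cases "(3::'l) = 0")
  case True
  \<comment> \<open>Here the unit itself has trace \<open>3 = 0\<close>.\<close>
  have "one \<noteq> 0"
    using T_cross_one[of e] T_nondegenerate[of e] e(1) by (auto simp: T_simps)
  then have "unit A \<noteq> 0" using h_unit h_zero by auto
  moreover have "\<phi> (unit A) = unit A" using \<phi> by (auto simp: Aut_def cubic_space_iso_def)
  moreover have "\<kappa> (trace_form A (unit A) (unit A)) = 0" using True T_one_one by (simp flip: T_h add: h_unit)
  then have "unit A \<in> trace_zero A" by (simp add: trace_zero_def field_extension_simps[OF extension])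
  ultimately show ?thesis by blast
next
  case three: False
  show ?thesis
  proof (rule ccontr)
    assume "\<not> ?thesis"
    then have free: "x = 0" if "x \<in> trace_zero A" "\<phi> x = x" for x using that by blast
    have "surj \<phi>" "\<And>x y. trace_form A (\<phi> x) (\<phi> y) = trace_form A x y"
      using \<phi> by (auto simp: Aut_def cubic_space_iso_def bij_is_surj)
    then obtain \<psi> where lin: "Vector_Spaces.linear scale scale \<psi>" and "\<forall>x. \<psi> (h x) = h (\<phi> x)"
      by (rule linear_extension)
    then have \<psi>: "\<psi> (h x) = h (\<phi> x)" for x by blast
    note ext = extension_preserves[OF \<phi> lin \<psi>]
    interpret fixed_point_free_automorphism scale one N sharp T \<psi>
    proof (intro fixed_point_free_automorphism.intro linear_operator.intro linear_operator_axioms.intro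
        fixed_point_free_automorphism_axioms.intro cubic_norm_structure_axioms vector_space_axioms)
      show "\<exists>B. finite B \<and> span B = UNIV"
        using span_image_h[OF fin(3)] fin(1) by blast
      show "x = 0" if "T x one = 0" "\<psi> x = x" for x
        using no_fixed_point_extends[OF fin three \<phi> lin \<psi> free that] .
    qed (use lin ext three roots in auto)
    show False using trace_zero_sharp_zero_imp_zero e by blast
  qed
qed

end

section \<open>Change of the base field of the split structure\<close>

fun J_map :: "('r \<Rightarrow> 's) \<Rightarrow> 'r mat3_triple \<Rightarrow> 's mat3_triple"
  where "J_map r (x, y, z) = (map_matrix r x, map_matrix r y, map_matrix r z)"

lemma map_matrix_field_extension:
  fixes r :: "'k::field \<Rightarrow> 'l::field" and x y a b :: "'k^3^3"
  assumes "field_extension r"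
  shows "map_matrix r (x + y) = map_matrix r x + map_matrix r y"
    and "map_matrix r (x - y) = map_matrix r x - map_matrix r y"
    and "map_matrix r (map_matrix ((*) c) x) = map_matrix ((*) (r c)) (map_matrix r x)"
    and "map_matrix r (a ** b) = map_matrix r a ** map_matrix r b"
    and "map_matrix r (adjugate3 a) = adjugate3 (map_matrix r a)"
    and "trace (map_matrix r a) = r (trace a)"
    and "map_matrix r 0 = 0" and "map_matrix r (mat 1) = mat 1"
  using field_extension_simps[OF assms]
  by (simp_all add: vec_eq_iff matrix_matrix_mult_def adjugate3_def trace_def sum_3 mat_def)

lemma J_map_field_extension:
  assumes "field_extension r"
  shows "J_map r (x + y) = J_map r x + J_map r y"
    and "J_map r (J_smult c x) = J_smult (r c) (J_map r x)"
    and "J_map r (mat 1, 0, 0) = (mat 1, 0, 0)"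
    and "J_map r (J_adj x) = J_adj (J_map r x)"
    and "J_trace_form (J_map r x) (J_map r y) = r (J_trace_form x y)"
  by (cases x; cases y; simp add: map_matrix_field_extension[OF assms]
      field_extension_simps[OF assms] flip: map_matrix_field_extension(4)[OF assms])+

text \<open>
  A triple over the larger field is a combination of 27 matrix units, which come from the smaller
  field.
\<close>

lemma span_range_J_map:
  assumes "field_extension (r :: 'k::field \<Rightarrow> 'l::field)"
  shows "module.span J_smult (range (J_map r)) = UNIV"
proof -
  interpret vector_space "J_smult :: 'l \<Rightarrow> _" by (rule vector_space_J_smult)
  define E :: "3 \<Rightarrow> 3 \<Rightarrow> 'k^3^3" where "E i j = (\<chi> k l. if k = i \<and> l = j then 1 else 0)" for i j
  have "y \<in> span (range (J_map r))" for y
  proof -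
    obtain a b c where y: "y = (a, b, c)" by (cases y)
    have E: "(\<Sum>i\<in>UNIV. \<Sum>j\<in>UNIV. map_matrix ((*) (x $ i $ j)) (map_matrix r (E i j))) = x" for x
      by (simp add: E_def sum_3 vec_eq_iff forall_3 field_extension_simps[OF assms])
    have "y = (\<Sum>i\<in>UNIV. \<Sum>j\<in>UNIV. J_smult (a $ i $ j) (J_map r (E i j, 0, 0)) +
        J_smult (b $ i $ j) (J_map r (0, E i j, 0)) + J_smult (c $ i $ j) (J_map r (0, 0, E i j)))"
      by (simp add: y prod_eq_iff fst_sum snd_sum E map_matrix_field_extension[OF assms]
          map_matrix_times_simps)
    also have "\<dots> \<in> span (range (J_map r))"
      by (intro span_sum span_add span_scale span_base rangeI)
    finally show ?thesis .
  qed
  then show ?thesis by auto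
qed

section \<open>Albert algebras\<close>

theorem theorem4p1:
  fixes A :: "('k::field, 'a::ab_group_add) cubic_space"
    and \<iota> :: "'k \<Rightarrow> 'f::field"
    and \<phi> :: "'a \<Rightarrow> 'a"
  assumes "albert_algebra_split_by \<iota> A"
    and "\<phi> \<in> Aut A"
  shows "\<exists>x\<^sub>0 \<in> trace_zero A. x\<^sub>0 \<noteq> 0 \<and> \<phi> x\<^sub>0 = x\<^sub>0"
proof -
  obtain E :: "('f, 'f^27) cubic_space" and j f
    where A: "cubic_space A" "vector_space.dim (smult A) UNIV = 27"
      and \<iota>: "field_extension \<iota>" and E: "smult E = (*s)"
      and j: "scalar_extension \<iota> A E j" and f: "cubic_space_iso E J_split f"
    using assms(1) by (auto simp: albert_algebra_split_by_def)
  obtain B where B: "module.independent (smult A) B" "module.span (smult A) B = UNIV"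
    and span_E: "module.span (smult E) (j ` B) = UNIV"
    using j by (auto simp: scalar_extension_def)
  interpret A: vector_space "smult A" using A(1) by (simp add: cubic_space_def)
  have "card B = 27" using A.dim_eq_card[of B UNIV] A(2) B by (simp add: A.span_UNIV)
  then have "finite B" using card.infinite by fastforce
  let ?\<kappa> = "\<lambda>c. to_ac (\<iota> c)"
  let ?h = "\<lambda>x. J_map to_ac (f (j x))"
  have to_ac: "field_extension (to_ac :: 'f \<Rightarrow> _)" by (simp add: field_extension_def)
  note J_map = J_map_field_extension[OF to_ac]
  have lin_f: "Vector_Spaces.linear (smult E) J_smult f" and bij: "bij f"
    and f_adj: "J_adj (f x) = f (adj E x)" and f_unit: "f (unit E) = (mat 1, 0, 0)"
    and f_T: "J_trace_form (f x) (f y) = trace_form E x y" for x y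
    using f by (simp_all add: cubic_space_iso_def J_split_def)
  have f_add: "f (x + y) = f x + f y" and f_smult: "f (smult E c x) = J_smult c (f x)" for x y c
    using lin_f by (simp_all add: Vector_Spaces.linear_iff)
  have span: "module.span J_smult (range ?h) = UNIV"
  proof -
    interpret E: vector_space "smult E" using lin_f by (simp add: Vector_Spaces.linear_iff)
    interpret J: vector_space "J_smult :: 'f alg_closure \<Rightarrow> _" by (rule vector_space_J_smult)
    interpret f: Vector_Spaces.linear "smult E" J_smult f by (rule lin_f)
    have "E.subspace {y. J_map to_ac (f y) \<in> J.span (range ?h)}"
    proof (rule E.subspaceI)
      have "J_map to_ac 0 = (0 :: 'f alg_closure mat3_triple)"
        using J_map(1)[of 0 0] by simp
      then show "0 \<in> {y. J_map to_ac (f y) \<in> J.span (range ?h)}"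
        by (simp add: f.zero J.span_zero)
    qed (simp_all add: f_add f_smult J_map J.span_add J.span_scale)
    then have "E.span (j ` B) \<subseteq> {y. J_map to_ac (f y) \<in> J.span (range ?h)}"
      by (rule E.span_minimal[rotated]) (auto intro: J.span_base)
    then have fy: "J_map to_ac (f y) \<in> J.span (range ?h)" for y using span_E by auto
    have "range (J_map to_ac) \<subseteq> J.span (range ?h)"
    proof (rule image_subsetI)
      fix z :: "'f mat3_triple"
      obtain y where "z = f y" using bij_is_surj[OF bij] by (rule surjE)
      then show "J_map to_ac z \<in> J.span (range ?h)" using fy by simp
    qed
    then show ?thesis
      using span_range_J_map[OF to_ac] J.span_minimal[OF _ J.subspace_span] by blast
  qed
  interpret cubic_space_embedding J_smult "(mat 1, 0, 0)" J_norm J_adj J_trace_form ?\<kappa> A ?h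
  proof (intro cubic_space_embedding.intro cubic_norm_structure_J cubic_space_embedding_axioms.intro A)
    show "field_extension ?\<kappa>" using \<iota> by (simp add: field_extension_def)
    show "?h (unit A) = (mat 1, 0, 0)"
      using j J_map(3) f_unit by (simp only: scalar_extension_def)
    show "?h (adj A x) = J_adj (?h x)" for x
      using j by (simp only: scalar_extension_def flip: J_map(4)) (simp add: f_adj)
  qed (use j span in \<open>simp_all add: scalar_extension_def J_map f_add f_smult f_T\<close>)
  \<comment> \<open>An off-diagonal matrix unit in the first component: it has rank one, so its adjoint vanishes.\<close>
  let ?e = "((\<chi> i j. if i = 1 \<and> j = 2 then 1 else 0), 0, 0) :: 'f alg_closure mat3_triple"
  show ?thesis
  proof (rule exists_fixed_trace_zero[OF \<open>finite B\<close> B _ assms(2), of ?e])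
    show "\<forall>p :: 'f alg_closure poly. degree p > 0 \<longrightarrow> (\<exists>r. poly p r = 0)"
      using alg_closed_imp_poly_has_root by blast
    show "?e \<noteq> 0" by (simp add: zero_prod_def vec_eq_iff)
    show "J_trace_form ?e (mat 1, 0, 0) = 0"
      unfolding J_trace_form_one by (simp add: trace_def sum_3)
    show "J_adj ?e = 0"
      by (simp add: zero_prod_def adjugate3_0 mult_zero_matrix)
        (simp add: adjugate3_def vec_eq_iff forall_3 numerals_mod_3)
  qed
qed

end
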